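(* For every integer $n\ge 0$ and all real numbers $x,y$, $$D_{n}^{(c)}(x,y)=\frac{n!}{2}\sum_{m=0}^{n}\frac{1}{m!}\big((x-1+iy)^{m}+(x-1-iy)^{m}\big),$$ and $$D_{n}^{(s)}(x,y)=\frac{n!}{2i}\sum_{m=0}^{n}\frac{1}{m!}\big((x-1+iy)^{m}-(x-1-iy)^{m}\big).$$
   Context: Here $i=\sqrt{-1}$. The cosine-derangement polynomials $D_n^{(c)}(x,y)$ and sine-derangement polynomials $D_n^{(s)}(x,y)$, $n\ge 0$, are defined by the generating functions (power series in $t$) $\displaystyle\frac{e^{-t}}{1-t}e^{xt}\cos(yt)=\sum_{n=0}^{\infty}D_{n}^{(c)}(x,y)\frac{t^{n}}{n!}$ and $\displaystyle\frac{e^{-t}}{1-t}e^{xt}\sin(yt)=\sum_{n=0}^{\infty}D_{n}^{(s)}(x,y)\frac{t^{n}}{n!}$. Convention: $0^0=1$. *)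

theory Defs
  imports Complex_Main "HOL-Computational_Algebra.Formal_Power_Series"
begin

text \<open>
  The generating functions are formal power series in \<open>t\<close> with real coefficients, for each fixed
  real \<open>x\<close> and \<open>y\<close>. Here \<^term>\<open>fps_exp c\<close>, \<^term>\<open>fps_cos c\<close> and \<^term>\<open>fps_sin c\<close> are the series of
  \<open>exp (c t)\<close>, \<open>cos (c t)\<close> and \<open>sin (c t)\<close>.
\<close>

definition cos_derangement_gf :: "real \<Rightarrow> real \<Rightarrow> real fps" where
  "cos_derangement_gf x y = fps_exp (- 1) / (1 - fps_X) * fps_exp x * fps_cos y"

definition sin_derangement_gf :: "real \<Rightarrow> real \<Rightarrow> real fps" where
  "sin_derangement_gf x y = fps_exp (- 1) / (1 - fps_X) * fps_exp x * fps_sin y"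

definition cos_derangement :: "nat \<Rightarrow> real \<Rightarrow> real \<Rightarrow> real" where
  "cos_derangement n x y = fact n * fps_nth (cos_derangement_gf x y) n"

definition sin_derangement :: "nat \<Rightarrow> real \<Rightarrow> real \<Rightarrow> real" where
  "sin_derangement n x y = fact n * fps_nth (sin_derangement_gf x y) n"

lemma cos_derangement_gf_eq:
  "fps_exp (- 1) / (1 - fps_X) * fps_exp x * fps_cos y =
     Abs_fps (\<lambda>n. cos_derangement n x y / fact n)"
  by (simp add: fps_eq_iff cos_derangement_def cos_derangement_gf_def)

lemma sin_derangement_gf_eq:
  "fps_exp (- 1) / (1 - fps_X) * fps_exp x * fps_sin y =
     Abs_fps (\<lambda>n. sin_derangement n x y / fact n)"
  by (simp add: fps_eq_iff sin_derangement_def sin_derangement_gf_def)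

end

theory Submission
  imports Defs
begin

text \<open>
  Since \<open>e\<^sup>-\<^sup>t e\<^sup>x\<^sup>t = e\<^sup>(\<^sup>x\<^sup>-\<^sup>1\<^sup>)\<^sup>t\<close>, both generating functions have the form \<open>g(t) / (1 - t)\<close>, where
  \<open>g(t)\<close> is \<open>e\<^sup>a\<^sup>t cos (y t)\<close> or \<open>e\<^sup>a\<^sup>t sin (y t)\<close> with \<open>a = x - 1\<close>. Dividing by \<open>1 - t\<close> replaces the
  coefficients by their partial sums, which is where the sum over \<open>m \<le> n\<close> comes from
  (\<open>cos_derangement_eq_sum\<close>, \<open>sin_derangement_eq_sum\<close>). The summands are found from Euler's formula:
  the coefficients \<open>c\<^sub>m\<close> and \<open>s\<^sub>m\<close> of the cosine and the sine series combine to
  \<open>c\<^sub>m + \<i> s\<^sub>m = (a + \<i> y)\<^sup>m / m!\<close> (\<open>exp_trig_nth_euler\<close>). Replacing \<open>y\<close> by \<open>- y\<close> gives the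
  conjugate equation, and half the sum and half the difference of the two isolate \<open>c\<^sub>m\<close> and \<open>\<i> s\<^sub>m\<close>.
\<close>

lemma fps_cos_of_real_nth: "fps_nth (fps_cos (complex_of_real b)) n = complex_of_real (fps_nth (fps_cos b) n)"
  by (simp add: fps_cos_def)

lemma fps_sin_of_real_nth: "fps_nth (fps_sin (complex_of_real b)) n = complex_of_real (fps_nth (fps_sin b) n)"
  by (simp add: fps_sin_def)

text \<open>
  Euler's formula, read off coefficientwise. The series on the left have real coefficients, so the
  identity \<open>e\<^sup>(\<^sup>a\<^sup>+\<^sup>\<i>\<^sup>b\<^sup>)\<^sup>t = e\<^sup>a\<^sup>t (cos (b t) + \<i> sin (b t))\<close> of complex series is transferred to them through the
  Cauchy product, whose terms commute with the embedding of the reals.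
\<close>

lemma exp_trig_nth_euler:
  fixes a b :: real
  shows "complex_of_real (fps_nth (fps_exp a * fps_cos b) m) +
           \<i> * complex_of_real (fps_nth (fps_exp a * fps_sin b) m) =
         (complex_of_real a + \<i> * complex_of_real b) ^ m / fact m"
proof -
  let ?A = "complex_of_real a" and ?B = "complex_of_real b"
  have "(?A + \<i> * ?B) ^ m / fact m = fps_nth (fps_exp (?A + \<i> * ?B)) m"
    by simp
  also have "fps_exp (?A + \<i> * ?B) =
      fps_exp ?A * fps_cos ?B + fps_const \<i> * (fps_exp ?A * fps_sin ?B)"
    by (simp only: fps_exp_add_mult fps_exp_ii_sin_cos) (simp add: algebra_simps)
  also have "fps_nth \<dots> m = fps_nth (fps_exp ?A * fps_cos ?B) m +
      \<i> * fps_nth (fps_exp ?A * fps_sin ?B) m"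
    by simp
  finally show ?thesis
    by (simp add: fps_mult_nth fps_cos_of_real_nth fps_sin_of_real_nth)
qed

lemma exp_trig_nth_euler_conjugate:
  fixes a b :: real
  shows "complex_of_real (fps_nth (fps_exp a * fps_cos b) m) -
           \<i> * complex_of_real (fps_nth (fps_exp a * fps_sin b) m) =
         (complex_of_real a - \<i> * complex_of_real b) ^ m / fact m"
  using exp_trig_nth_euler[of a "- b" m] by (simp add: fps_cos_odd fps_sin_even)

lemma exp_cos_nth:
  fixes a b :: real
  shows "complex_of_real (fps_nth (fps_exp a * fps_cos b) m) =
         1 / 2 * (1 / fact m * ((complex_of_real a + \<i> * complex_of_real b) ^ m +
                                (complex_of_real a - \<i> * complex_of_real b) ^ m))"
proof -
  have "2 * complex_of_real (fps_nth (fps_exp a * fps_cos b) m) =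
        (complex_of_real a + \<i> * complex_of_real b) ^ m / fact m +
        (complex_of_real a - \<i> * complex_of_real b) ^ m / fact m"
    unfolding exp_trig_nth_euler[symmetric] exp_trig_nth_euler_conjugate[symmetric] by simp
  then show ?thesis
    by (simp add: field_simps)
qed

lemma exp_sin_nth:
  fixes a b :: real
  shows "complex_of_real (fps_nth (fps_exp a * fps_sin b) m) =
         1 / (2 * \<i>) * (1 / fact m * ((complex_of_real a + \<i> * complex_of_real b) ^ m -
                                      (complex_of_real a - \<i> * complex_of_real b) ^ m))"
proof -
  have "2 * \<i> * complex_of_real (fps_nth (fps_exp a * fps_sin b) m) =
        (complex_of_real a + \<i> * complex_of_real b) ^ m / fact m -
        (complex_of_real a - \<i> * complex_of_real b) ^ m / fact m"
    unfolding exp_trig_nth_euler[symmetric] exp_trig_nth_euler_conjugate[symmetric] by simp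
  then show ?thesis
    by (simp add: field_simps)
qed

text \<open>
  The trigonometric factor \<open>f\<close> is kept arbitrary so that the cosine and the sine case share the
  argument: the exponentials merge, and \<open>1 / (1 - t)\<close> is the series with all coefficients \<open>1\<close>, so
  its Cauchy product with any series forms partial sums.
\<close>

lemma derangement_gf_nth:
  fixes f :: "real fps"
  shows "fps_nth (fps_exp (- 1) / (1 - fps_X) * fps_exp x * f) n =
         (\<Sum>m=0..n. fps_nth (fps_exp (x - 1) * f) m)"
proof -
  have "fps_exp (- 1) / (1 - fps_X) * fps_exp x * f =
        fps_exp (- 1) * fps_exp x * f / (1 - fps_X)"
    by (simp add: fps_divide_unit algebra_simps)
  also have "fps_exp (- 1) * fps_exp x = fps_exp (x - 1)"
    by (simp flip: fps_exp_add_mult)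
  finally show ?thesis
    by (simp add: fps_divide_fps_X_minus1_sum)
qed

lemma cos_derangement_eq_sum:
  "cos_derangement n x y = fact n * (\<Sum>m=0..n. fps_nth (fps_exp (x - 1) * fps_cos y) m)"
  by (simp only: cos_derangement_def cos_derangement_gf_def derangement_gf_nth)

lemma sin_derangement_eq_sum:
  "sin_derangement n x y = fact n * (\<Sum>m=0..n. fps_nth (fps_exp (x - 1) * fps_sin y) m)"
  by (simp only: sin_derangement_def sin_derangement_gf_def derangement_gf_nth)

theorem theorem6:
  fixes n :: nat and x y :: real
  shows "complex_of_real (cos_derangement n x y) =
           fact n / 2 *
             (\<Sum>m=0..n. 1 / fact m *
               ((complex_of_real x - 1 + \<i> * complex_of_real y) ^ m +
                (complex_of_real x - 1 - \<i> * complex_of_real y) ^ m))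
         \<and>
         complex_of_real (sin_derangement n x y) =
           fact n / (2 * \<i>) *
             (\<Sum>m=0..n. 1 / fact m *
               ((complex_of_real x - 1 + \<i> * complex_of_real y) ^ m -
                (complex_of_real x - 1 - \<i> * complex_of_real y) ^ m))"
  unfolding cos_derangement_eq_sum sin_derangement_eq_sum of_real_mult of_real_sum
    exp_cos_nth exp_sin_nth sum_distrib_left[symmetric]
  by simp

end
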